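(* Let $\mathrm{R}_5=\{a_0,a_1,a_2,a_3,a_4\}$ be the dihedral quandle of order 5, and put $e_i=a_i-a_0\in\mathbb{Z}[\mathrm{R}_5]$ for $i=1,2,3,4$. Then $\Delta^2(\mathrm{R}_5)$ is generated as an abelian group by $\{e_1-e_2-e_4,\ e_2+2e_4,\ e_3+3e_4,\ 5e_4\}$, and $\Delta(\mathrm{R}_5)/\Delta^2(\mathrm{R}_5)\cong\mathbb{Z}_5$.
   Context: The dihedral quandle $\mathrm{R}_n=\{a_0,\dots,a_{n-1}\}$ has operation $a_i.a_j=a_{2j-i}$, indices modulo $n$. $\mathbb{Z}[\mathrm{R}_n]$ is the free abelian group on $\mathrm{R}_n$ with the bilinear extension of this operation as (non-associative) multiplication. $\Delta(\mathrm{R}_n)$ is the kernel of the augmentation map $\mathbb{Z}[\mathrm{R}_n]\to\mathbb{Z}$, $\sum_i\alpha_i a_i\mapsto\sum_i\alpha_i$, and $\Delta^2(\mathrm{R}_n)$ is the additive subgroup generated by all products $u.v$ with $u,v\in\Delta(\mathrm{R}_n)$. $\mathbb{Z}_5=\mathbb{Z}/5\mathbb{Z}$. *)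

theory Defs
  imports "HOL-Algebra.Free_Abelian_Groups" "HOL-Algebra.Generated_Groups"
begin

text \<open>The element \<open>a\<^sub>i\<close> of the dihedral quandle is encoded by its index \<open>i \<in> {0..<n}\<close>; the
  corresponding basis element of the free abelian group on it is \<open>frag_of i\<close>.\<close>

definition dihedral_quandle :: "nat \<Rightarrow> int set"
  where "dihedral_quandle n = {0..<int n}"

definition dihedral_op :: "nat \<Rightarrow> int \<Rightarrow> int \<Rightarrow> int"
  where "dihedral_op n i j = (2 * j - i) mod int n"

definition quandle_ring_mult ::
    "('a \<Rightarrow> 'a \<Rightarrow> 'a) \<Rightarrow> ('a \<Rightarrow>\<^sub>0 int) \<Rightarrow> ('a \<Rightarrow>\<^sub>0 int) \<Rightarrow> ('a \<Rightarrow>\<^sub>0 int)"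
  where "quandle_ring_mult opr u v =
    frag_extend (\<lambda>x. frag_extend (\<lambda>y. frag_of (opr x y)) v) u"

definition augmentation :: "('a \<Rightarrow>\<^sub>0 int) \<Rightarrow> int"
  where "augmentation u = (\<Sum>x\<in>Poly_Mapping.keys u. Poly_Mapping.lookup u x)"

definition aug_ideal :: "'a set \<Rightarrow> ('a \<Rightarrow>\<^sub>0 int) set"
  where "aug_ideal X = kernel (free_Abelian_group X) integer_group augmentation"

definition aug_ideal_sq :: "'a set \<Rightarrow> ('a \<Rightarrow> 'a \<Rightarrow> 'a) \<Rightarrow> ('a \<Rightarrow>\<^sub>0 int) set"
  where "aug_ideal_sq X opr = generate (free_Abelian_group X)
    {quandle_ring_mult opr u v | u v. u \<in> aug_ideal X \<and> v \<in> aug_ideal X}"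

definition aug_ideal_group :: "'a set \<Rightarrow> ('a \<Rightarrow>\<^sub>0 int) monoid"
  where "aug_ideal_group X = (free_Abelian_group X)\<lparr>carrier := aug_ideal X\<rparr>"


lemma dihedral_op_closed:
  "i \<in> dihedral_quandle n \<Longrightarrow> dihedral_op n i j \<in> dihedral_quandle n"
  by (auto simp: dihedral_quandle_def dihedral_op_def)

lemma quandle_ring_mult_basis [simp]:
  "quandle_ring_mult opr (frag_of x) (frag_of y) = frag_of (opr x y)"
  by (simp add: quandle_ring_mult_def)

lemma quandle_ring_mult_add_left:
  "quandle_ring_mult opr (u + u') v = quandle_ring_mult opr u v + quandle_ring_mult opr u' v"
  by (simp add: quandle_ring_mult_def frag_extend_add)

lemma quandle_ring_mult_add_right:
  "quandle_ring_mult opr u (v + v') = quandle_ring_mult opr u v + quandle_ring_mult opr u v'"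
  by (simp add: quandle_ring_mult_def frag_extend_add)
     (simp add: frag_extend_def frag_cmul_distrib2 sum.distrib)

lemma augmentation_superset:
  "finite A \<Longrightarrow> Poly_Mapping.keys u \<subseteq> A \<Longrightarrow> augmentation u = (\<Sum>x\<in>A. Poly_Mapping.lookup u x)"
  unfolding augmentation_def by (rule sum.mono_neutral_left) (auto simp: in_keys_iff)

lemma augmentation_0 [simp]: "augmentation 0 = 0"
  by (simp add: augmentation_def)

lemma augmentation_frag_of [simp]: "augmentation (frag_of x) = 1"
  by (simp add: augmentation_def keys_frag_of)

lemma augmentation_add: "augmentation (u + v) = augmentation u + augmentation v"
proof -
  let ?A = "Poly_Mapping.keys u \<union> Poly_Mapping.keys v"
  have "augmentation (u + v) = (\<Sum>x\<in>?A. Poly_Mapping.lookup (u + v) x)"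
    by (rule augmentation_superset) (auto simp: in_keys_iff lookup_add)
  then show ?thesis
    by (simp add: lookup_add sum.distrib augmentation_superset[of ?A u]
        augmentation_superset[of ?A v])
qed

lemma augmentation_cmul: "augmentation (frag_cmul c u) = c * augmentation u"
proof -
  have "augmentation (frag_cmul c u) = (\<Sum>x\<in>Poly_Mapping.keys u. Poly_Mapping.lookup (frag_cmul c u) x)"
    by (rule augmentation_superset) auto
  then show ?thesis
    by (simp add: augmentation_def sum_distrib_left)
qed

lemma augmentation_sum:
  "finite A \<Longrightarrow> augmentation (\<Sum>x\<in>A. f x) = (\<Sum>x\<in>A. augmentation (f x))"
  by (induction A rule: finite_induct) (simp_all add: augmentation_add)

lemma augmentation_mult:
  "augmentation (quandle_ring_mult opr u v) = augmentation u * augmentation v"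
  unfolding quandle_ring_mult_def frag_extend_def
  by (simp add: augmentation_sum augmentation_cmul)
     (simp add: augmentation_def sum_distrib_right)

lemma augmentation_hom: "group_hom (free_Abelian_group X) integer_group augmentation"
  by (simp add: group_hom_def group_hom_axioms_def hom_def augmentation_add)

lemma keys_quandle_ring_mult:
  assumes "\<And>x y. x \<in> X \<Longrightarrow> y \<in> X \<Longrightarrow> opr x y \<in> X"
    and "Poly_Mapping.keys u \<subseteq> X" "Poly_Mapping.keys v \<subseteq> X"
  shows "Poly_Mapping.keys (quandle_ring_mult opr u v) \<subseteq> X"
proof -
  have "Poly_Mapping.keys (frag_extend (\<lambda>y. frag_of (opr x y)) v) \<subseteq> X" if "x \<in> X" for x
    by (rule order_trans[OF keys_frag_extend]) (use assms that in \<open>auto simp: keys_frag_of\<close>)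
  then show ?thesis
    unfolding quandle_ring_mult_def
    by (intro order_trans[OF keys_frag_extend]) (use assms in blast)
qed

lemma aug_ideal_iff:
  "u \<in> aug_ideal X \<longleftrightarrow> Poly_Mapping.keys u \<subseteq> X \<and> augmentation u = 0"
  by (simp add: aug_ideal_def kernel_def)

text \<open>The quotient \<open>aug_ideal_group X Mod aug_ideal_sq X opr\<close> is a genuine quotient group.\<close>

lemma aug_ideal_sq_normal:
  assumes "\<And>x y. x \<in> X \<Longrightarrow> y \<in> X \<Longrightarrow> opr x y \<in> X"
  shows "aug_ideal_sq X opr \<lhd> aug_ideal_group X"
proof -
  let ?F = "free_Abelian_group X"
  interpret F: comm_group ?F by (rule abelian_free_Abelian_group)
  interpret h: group_hom ?F integer_group augmentation by (rule augmentation_hom)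
  let ?P = "{quandle_ring_mult opr u v | u v. u \<in> aug_ideal X \<and> v \<in> aug_ideal X}"
  have K: "subgroup (aug_ideal X) ?F"
    unfolding aug_ideal_def by (rule h.subgroup_kernel)
  have P: "?P \<subseteq> aug_ideal X"
    using keys_quandle_ring_mult[of X opr] assms by (force simp: aug_ideal_iff augmentation_mult)
  have S: "aug_ideal_sq X opr \<subseteq> aug_ideal X"
    unfolding aug_ideal_sq_def by (rule F.generate_subgroup_incl[OF P K])
  have "subgroup (aug_ideal_sq X opr) ?F"
    unfolding aug_ideal_sq_def
    by (rule F.generate_is_subgroup) (use P K subgroup.subset in blast)
  then have "subgroup (aug_ideal_sq X opr) (aug_ideal_group X)"
    unfolding aug_ideal_group_def by (rule F.subgroup_incl[OF _ K S])
  moreover have "comm_group (aug_ideal_group X)"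
    unfolding aug_ideal_group_def
    by (rule group.group_comm_groupI[OF F.subgroup_imp_group[OF K]]) (simp add: add.commute)
  ultimately show ?thesis
    by (simp add: comm_group.normal_iff_subgroup)
qed

end

theory Submission
  imports Defs "HOL-Number_Theory.Cong"
begin

text \<open>On the augmentation ideal, \<open>\<Sum>\<^sub>i \<alpha>\<^sub>i a\<^sub>i \<mapsto> \<Sum>\<^sub>i i \<alpha>\<^sub>i mod n\<close> is a surjective homomorphism to
  \<open>\<int>\<^sub>n\<close>. It kills every product \<open>u.v\<close>, since modulo \<open>n\<close> its value there is
  \<open>2 \<epsilon>(u) w(v) - w(u) \<epsilon>(v)\<close>, where \<open>\<epsilon>\<close> is the augmentation and \<open>w\<close> the weighted sum. For \<open>n = 5\<close>,
  triangular elimination shows that the four listed elements generate the kernel, and each of them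
  is an integer combination of the products \<open>e\<^sub>i.e\<^sub>j = e\<^bsub>2j-i\<^esub> - e\<^bsub>-i\<^esub> - e\<^bsub>2j\<^esub>\<close>; hence
  the kernel is the square of the augmentation ideal.\<close>

section \<open>The integer-valued weighted index sum and its value on products\<close>

definition index_weight :: "(int \<Rightarrow>\<^sub>0 int) \<Rightarrow> int"
  where "index_weight u = (\<Sum>x\<in>Poly_Mapping.keys u. Poly_Mapping.lookup u x * x)"

lemma index_weight_superset:
  "finite A \<Longrightarrow> Poly_Mapping.keys u \<subseteq> A \<Longrightarrow>
    index_weight u = (\<Sum>x\<in>A. Poly_Mapping.lookup u x * x)"
  unfolding index_weight_def by (rule sum.mono_neutral_left) (auto simp: in_keys_iff)

lemma index_weight_0 [simp]: "index_weight 0 = 0"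
  by (simp add: index_weight_def)

lemma index_weight_frag_of [simp]: "index_weight (frag_of x) = x"
  by (simp add: index_weight_def keys_frag_of)

lemma index_weight_add: "index_weight (u + v) = index_weight u + index_weight v"
proof -
  let ?A = "Poly_Mapping.keys u \<union> Poly_Mapping.keys v"
  have "index_weight (u + v) = (\<Sum>x\<in>?A. Poly_Mapping.lookup (u + v) x * x)"
    by (rule index_weight_superset) (auto simp: in_keys_iff lookup_add)
  then show ?thesis
    by (simp add: lookup_add sum.distrib distrib_right index_weight_superset[of ?A u]
        index_weight_superset[of ?A v])
qed

lemma index_weight_cmul: "index_weight (frag_cmul c u) = c * index_weight u"
proof -
  have "index_weight (frag_cmul c u) =
      (\<Sum>x\<in>Poly_Mapping.keys u. Poly_Mapping.lookup (frag_cmul c u) x * x)"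
    by (rule index_weight_superset) auto
  then show ?thesis
    by (simp add: index_weight_def sum_distrib_left mult.assoc)
qed

lemma index_weight_sum: "index_weight (\<Sum>x\<in>A. f x) = (\<Sum>x\<in>A. index_weight (f x))"
  by (induction A rule: infinite_finite_induct) (simp_all add: index_weight_add)

lemma index_weight_mult_cong:
  "[index_weight (quandle_ring_mult (dihedral_op n) u v) =
      2 * augmentation u * index_weight v - index_weight u * augmentation v] (mod int n)"
proof -
  let ?U = "Poly_Mapping.keys u" and ?V = "Poly_Mapping.keys v"
  let ?u = "Poly_Mapping.lookup u" and ?v = "Poly_Mapping.lookup v"
  have "index_weight (quandle_ring_mult (dihedral_op n) u v) =
      (\<Sum>x\<in>?U. ?u x * (\<Sum>y\<in>?V. ?v y * ((2 * y - x) mod int n)))"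
    by (simp add: quandle_ring_mult_def frag_extend_def index_weight_sum index_weight_cmul
        dihedral_op_def)
  \<comment> \<open>Dropping the inner reduction changes the value only by a multiple of
    \<open>n\<close>; what remains is linear in \<open>x\<close> and in \<open>y\<close>, so the
    double sum splits.\<close>
  moreover have "[(\<Sum>x\<in>?U. ?u x * (\<Sum>y\<in>?V. ?v y * ((2 * y - x) mod int n))) =
      (\<Sum>x\<in>?U. ?u x * (\<Sum>y\<in>?V. ?v y * (2 * y - x)))] (mod int n)"
    by (intro cong_sum cong_mult cong_refl) (simp add: cong_def)
  moreover have "(\<Sum>x\<in>?U. ?u x * (\<Sum>y\<in>?V. ?v y * (2 * y - x))) =
      2 * augmentation u * index_weight v - index_weight u * augmentation v"
  proof -
    have "(\<Sum>y\<in>?V. ?v y * (2 * y - x)) = 2 * index_weight v - x * augmentation v" for x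
      by (simp add: augmentation_def index_weight_def sum_subtractf sum_distrib_left
          algebra_simps)
    then have "(\<Sum>x\<in>?U. ?u x * (\<Sum>y\<in>?V. ?v y * (2 * y - x))) =
        (\<Sum>x\<in>?U. ?u x * (2 * index_weight v) - ?u x * x * augmentation v)"
      by (simp add: right_diff_distrib mult.assoc)
    then show ?thesis
      unfolding sum_subtractf sum_distrib_right[symmetric] augmentation_def[of u]
        index_weight_def[of u]
      by simp
  qed
  ultimately show ?thesis
    by simp
qed

section \<open>The homomorphism to the integers modulo n and its kernel\<close>

lemma aug_ideal_subgroup: "subgroup (aug_ideal X) (free_Abelian_group X)"
  unfolding aug_ideal_def by (rule group_hom.subgroup_kernel[OF augmentation_hom])

lemma index_weight_mod_hom:
  assumes "n > 0"
  shows "group_hom (aug_ideal_group X) (integer_mod_group n) (\<lambda>u. index_weight u mod int n)"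
proof -
  have "group (aug_ideal_group X)"
    unfolding aug_ideal_group_def
    by (rule group.subgroup_imp_group[OF group_free_Abelian_group aug_ideal_subgroup])
  then show ?thesis
    using assms
    by (simp add: group_hom_def group_hom_axioms_def hom_def carrier_integer_mod_group
        aug_ideal_group_def index_weight_add mod_add_eq)
qed

lemma index_weight_mod_surj:
  assumes "n > 1"
  shows "(\<lambda>u. index_weight u mod int n) ` aug_ideal (dihedral_quandle n) = {0..<int n}"
proof (intro equalityI subsetI)
  fix k assume k: "k \<in> {0..<int n}"
  \<comment> \<open>Subtracting \<open>frag_of 0\<close> makes the augmentation vanish and leaves
    the weight \<open>k\<close> unchanged, since index 0 has weight 0.\<close>
  let ?u = "frag_of k + frag_cmul (-1) (frag_of 0)"
  have "Poly_Mapping.keys ?u \<subseteq> dihedral_quandle n"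
    using k by (intro order_trans[OF keys_add]) (auto simp: keys_frag_of dihedral_quandle_def)
  then have "?u \<in> aug_ideal (dihedral_quandle n)"
    unfolding aug_ideal_iff augmentation_add augmentation_cmul augmentation_frag_of by simp
  moreover have "index_weight ?u = k"
    unfolding index_weight_add index_weight_cmul index_weight_frag_of by simp
  then have "k = index_weight ?u mod int n"
    using k by simp
  ultimately show "k \<in> (\<lambda>u. index_weight u mod int n) ` aug_ideal (dihedral_quandle n)"
    by blast
qed (use assms in auto)

lemma kernel_index_weight_mod:
  "kernel (aug_ideal_group X) (integer_mod_group n) (\<lambda>u. index_weight u mod int n) =
    {u \<in> aug_ideal X. int n dvd index_weight u}"
  by (auto simp: kernel_def aug_ideal_group_def)

text \<open>With this, inclusion of the generated square in the kernel need only be checked on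
  single products.\<close>

lemma index_weight_kernel_subgroup:
  "subgroup {u \<in> aug_ideal X. m dvd index_weight u} (free_Abelian_group X)"
proof
  fix u assume u: "u \<in> {u \<in> aug_ideal X. m dvd index_weight u}"
  have "- u = frag_cmul (-1) u" by simp
  then have "augmentation (- u) = - augmentation u" "index_weight (- u) = - index_weight u"
    using augmentation_cmul[of "-1" u] index_weight_cmul[of "-1" u] by auto
  with u show "inv\<^bsub>free_Abelian_group X\<^esub> u \<in> {u \<in> aug_ideal X. m dvd index_weight u}"
    by (auto simp: aug_ideal_iff)
next
  fix u v
  assume "u \<in> {u \<in> aug_ideal X. m dvd index_weight u}"
    and "v \<in> {u \<in> aug_ideal X. m dvd index_weight u}"
  then show "u \<otimes>\<^bsub>free_Abelian_group X\<^esub> v \<in> {u \<in> aug_ideal X. m dvd index_weight u}"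
    using keys_add[of u v] by (auto simp: aug_ideal_iff augmentation_add index_weight_add)
qed (auto simp: aug_ideal_iff)

lemma aug_ideal_sq_subset_index_weight_kernel:
  "aug_ideal_sq (dihedral_quandle n) (dihedral_op n) \<subseteq>
    {u \<in> aug_ideal (dihedral_quandle n). int n dvd index_weight u}"
  unfolding aug_ideal_sq_def
proof (rule group.generate_subgroup_incl[OF group_free_Abelian_group _ index_weight_kernel_subgroup],
    clarify)
  fix u v
  assume u: "u \<in> aug_ideal (dihedral_quandle n)" and v: "v \<in> aug_ideal (dihedral_quandle n)"
  let ?w = "quandle_ring_mult (dihedral_op n) u v"
  have "?w \<in> aug_ideal (dihedral_quandle n)"
    using u v keys_quandle_ring_mult[of "dihedral_quandle n" "dihedral_op n" u v]
    by (auto simp: aug_ideal_iff augmentation_mult dihedral_op_closed)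
  \<comment> \<open>Both augmentations are 0, so both terms of the product congruence
    vanish.\<close>
  moreover have "int n dvd index_weight ?w"
    using index_weight_mult_cong[of n u v] u v by (simp add: aug_ideal_iff cong_0_iff)
  ultimately show "?w \<in> aug_ideal (dihedral_quandle n) \<and> int n dvd index_weight ?w"
    by blast
qed

section \<open>Integer combinations in subgroups, and the generators for n = 5\<close>

lemma subgroup_frag_cmul:
  assumes "subgroup H (free_Abelian_group X)" "u \<in> H"
  shows "frag_cmul c u \<in> H"
proof -
  have "u [^]\<^bsub>free_Abelian_group X\<^esub> c \<in> H"
    by (rule group.subgroup_int_pow_closed[OF group_free_Abelian_group assms])
  moreover have "Poly_Mapping.keys u \<subseteq> X"
    using subgroup.mem_carrier[OF assms] by simp
  ultimately show ?thesis
    by simp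
qed

lemma subgroup_frag_add:
  "subgroup H (free_Abelian_group X) \<Longrightarrow> u \<in> H \<Longrightarrow> v \<in> H \<Longrightarrow> u + v \<in> H"
  using subgroup.m_closed by fastforce

lemma quandle_ring_mult_diff_basis:
  "quandle_ring_mult opr (frag_of a - frag_of b) (frag_of c - frag_of d) =
    frag_of (opr a c) - frag_of (opr a d) - frag_of (opr b c) + frag_of (opr b d)"
  by (simp add: quandle_ring_mult_def frag_extend_diff)

text \<open>The first three generators have weights -5, 10 and 15. Subtracting suitable multiples of
  them from a kernel element leaves \<open>c * e 4\<close> with \<open>4 * c\<close> divisible by 5,
  hence \<open>c\<close> divisible by 5.\<close>

lemma dihedral5_kernel_subset_generate:
  fixes e :: "int \<Rightarrow> (int \<Rightarrow>\<^sub>0 int)"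
  assumes e: "\<And>i. i \<in> {1, 2, 3, 4} \<Longrightarrow> e i = frag_of i - frag_of 0"
  shows "{u \<in> aug_ideal (dihedral_quandle 5). 5 dvd index_weight u} \<subseteq>
      generate (free_Abelian_group (dihedral_quandle 5))
        {e 1 - e 2 - e 4, e 2 + frag_cmul 2 (e 4), e 3 + frag_cmul 3 (e 4), frag_cmul 5 (e 4)}"
    (is "_ \<subseteq> generate ?F ?S")
proof clarify
  fix u assume u: "u \<in> aug_ideal (dihedral_quandle 5)" and "5 dvd index_weight u"
  then obtain k where k: "index_weight u = 5 * k" by blast
  have X: "dihedral_quandle 5 = {0, 1, 2, 3, 4}"
    by (auto simp: dihedral_quandle_def)
  have keys: "Poly_Mapping.keys u \<subseteq> {0, 1, 2, 3, 4}"
    using u by (simp add: aug_ideal_iff X)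
  let ?c = "Poly_Mapping.lookup u"
  have aug: "?c 0 + ?c 1 + ?c 2 + ?c 3 + ?c 4 = 0"
    using u augmentation_superset[OF _ keys] by (simp add: aug_ideal_iff)
  have wt: "?c 1 + 2 * ?c 2 + 3 * ?c 3 + 4 * ?c 4 = 5 * k"
    using k index_weight_superset[OF _ keys] by simp
  \<comment> \<open>The coefficients are read off in the order \<open>e 1\<close>,
    \<open>e 2\<close>, \<open>e 3\<close>. The remaining multiple of \<open>e 4\<close> is
    \<open>?c 4 - ?c 1 - 2 * ?c 2 - 3 * ?c 3\<close>, which \<open>wt\<close> turns into
    \<open>5 * (?c 4 - k)\<close>; \<open>aug\<close> settles index 0.\<close>
  have eq: "u = frag_cmul (?c 1) (e 1 - e 2 - e 4)
      + frag_cmul (?c 1 + ?c 2) (e 2 + frag_cmul 2 (e 4))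
      + frag_cmul (?c 3) (e 3 + frag_cmul 3 (e 4)) + frag_cmul (?c 4 - k) (frag_cmul 5 (e 4))"
    (is "u = ?r")
  proof (rule poly_mapping_eqI)
    fix i :: int
    consider "i \<in> {0, 1, 2, 3, 4}" | "i \<notin> {0, 1, 2, 3, 4}" by blast
    then show "?c i = Poly_Mapping.lookup ?r i"
    proof cases
      case 1
      then show ?thesis
        using aug wt by (auto simp: e lookup_add lookup_minus algebra_simps simp del: single_one)
    next
      case 2
      then have "?c i = 0"
        using keys by (meson in_keys_iff subsetD)
      then show ?thesis
        using 2 by (simp add: e lookup_add lookup_minus del: single_one)
    qed
  qed
  have ke: "Poly_Mapping.keys (e i) \<subseteq> dihedral_quandle 5" if "i \<in> {1, 2, 3, 4}" for i
    unfolding e[OF that] using that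
    by (intro order_trans[OF keys_diff]) (auto simp: keys_frag_of X)
  have "?S \<subseteq> carrier ?F"
    using ke[of 1] ke[of 2] ke[of 3] ke[of 4]
    by (auto dest!: subsetD[OF keys_add] subsetD[OF keys_diff])
  then have sub: "subgroup (generate ?F ?S) ?F"
    by (rule group.generate_is_subgroup[OF group_free_Abelian_group])
  note eq
  also have "?r \<in> generate ?F ?S"
    by (intro subgroup_frag_add[OF sub] subgroup_frag_cmul[OF sub] generate.incl) auto
  finally show "u \<in> generate ?F ?S" .
qed

text \<open>The four products with left factor \<open>e 1\<close> already yield all the
  generators.\<close>

lemma dihedral5_generate_subset_aug_ideal_sq:
  fixes e :: "int \<Rightarrow> (int \<Rightarrow>\<^sub>0 int)"
  assumes e: "\<And>i. i \<in> {1, 2, 3, 4} \<Longrightarrow> e i = frag_of i - frag_of 0"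
  shows "generate (free_Abelian_group (dihedral_quandle 5))
        {e 1 - e 2 - e 4, e 2 + frag_cmul 2 (e 4), e 3 + frag_cmul 3 (e 4), frag_cmul 5 (e 4)}
      \<subseteq> aug_ideal_sq (dihedral_quandle 5) (dihedral_op 5)"
proof -
  let ?F = "free_Abelian_group (dihedral_quandle 5)"
  let ?D = "aug_ideal_sq (dihedral_quandle 5) (dihedral_op 5)"
  let ?p = "\<lambda>i j. quandle_ring_mult (dihedral_op 5) (e i) (e j)"
  \<comment> \<open>Normality gives a subgroup of the augmentation ideal, which is itself a subgroup
    of \<open>?F\<close>; closure under integer combinations is wanted in \<open>?F\<close>.\<close>
  have "?D \<lhd> aug_ideal_group (dihedral_quandle 5)"
    by (rule aug_ideal_sq_normal) (rule dihedral_op_closed)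
  then have "subgroup ?D (?F\<lparr>carrier := aug_ideal (dihedral_quandle 5)\<rparr>)"
    by (simp add: normal_imp_subgroup aug_ideal_group_def)
  then have sub: "subgroup ?D ?F"
    using group.incl_subgroup[OF group_free_Abelian_group aug_ideal_subgroup] by blast
  note lookups = lookup_add lookup_minus lookup_uminus lookup_frag_cmul
  note closed = subgroup_frag_add[OF sub] subgroup_frag_cmul[OF sub]
  have "e i \<in> aug_ideal (dihedral_quandle 5)" if i: "i \<in> {1, 2, 3, 4}" for i
  proof -
    have "Poly_Mapping.keys (e i) \<subseteq> dihedral_quandle 5"
      unfolding e[OF i] using i
      by (intro order_trans[OF keys_diff]) (auto simp: keys_frag_of dihedral_quandle_def)
    moreover have "augmentation (e i) = 0"
      \<comment> \<open>Adding \<open>frag_of 0\<close> back gives \<open>frag_of i\<close>, so the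
        augmentation of \<open>e i\<close> plus 1 equals 1.\<close>
      using augmentation_add[of "frag_of i - frag_of 0" "frag_of 0"]
      unfolding e[OF i] diff_add_cancel augmentation_frag_of by simp
    ultimately show ?thesis
      by (simp add: aug_ideal_iff)
  qed
  then have prod: "?p i j \<in> ?D" if "i \<in> {1, 2, 3, 4}" "j \<in> {1, 2, 3, 4}" for i j
    using that unfolding aug_ideal_sq_def by (intro generate.incl) blast
  have p11: "?p 1 1 = e 1 - e 2 - e 4"
    and p12: "?p 1 2 = e 3 - e 4 - e 4"
    and p13: "?p 1 3 = - e 1 - e 4"
    and p14: "?p 1 4 = e 2 - e 3 - e 4"
    by (simp_all add: e quandle_ring_mult_diff_basis dihedral_op_def
        poly_mapping_eq_iff fun_eq_iff lookup_add lookup_minus del: single_one)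
  have g1: "e 1 - e 2 - e 4 \<in> ?D"
    using prod[of 1 1] by (simp add: p11)
  \<comment> \<open>As j runs over all residues modulo 5, so do 2j-1 and 2j; summing e_{2j-1} - e_4
    - e_{2j} therefore leaves -5 e_4, and j = 0 contributes nothing.\<close>
  have "frag_cmul 5 (e 4) = frag_cmul (-1) (?p 1 1 + ?p 1 2 + ?p 1 3 + ?p 1 4)"
    unfolding p11 p12 p13 p14
    by (rule poly_mapping_eqI, simp only: lookups, simp)
  also have "\<dots> \<in> ?D"
    by (intro closed prod) auto
  finally have g4: "frag_cmul 5 (e 4) \<in> ?D" .
  \<comment> \<open>These are the two products in which \<open>e 1\<close> occurs, with opposite
    signs.\<close>
  have "e 2 + frag_cmul 2 (e 4) = frag_cmul (-1) (?p 1 1 + ?p 1 3)"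
    unfolding p11 p13
    by (rule poly_mapping_eqI, simp only: lookups, simp)
  also have "\<dots> \<in> ?D"
    by (intro closed prod) auto
  finally have g2: "e 2 + frag_cmul 2 (e 4) \<in> ?D" .
  \<comment> \<open>The product has coefficient -2 at \<open>e 4\<close>, which the multiple of 5
    just obtained shifts to 3.\<close>
  have "e 3 + frag_cmul 3 (e 4) = ?p 1 2 + frag_cmul 5 (e 4)"
    unfolding p12
    by (rule poly_mapping_eqI, simp only: lookups)
  also have "\<dots> \<in> ?D"
    by (intro closed prod g4) auto
  finally have g3: "e 3 + frag_cmul 3 (e 4) \<in> ?D" .
  show ?thesis
    by (rule group.generate_subgroup_incl[OF group_free_Abelian_group _ sub])
      (simp add: g1 g2 g3 g4)
qed

theorem proposition6p4:
  fixes e :: "int \<Rightarrow> (int \<Rightarrow>\<^sub>0 int)"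
  assumes e: "\<And>i. i \<in> {1, 2, 3, 4} \<Longrightarrow> e i = frag_of i - frag_of 0"
  shows "aug_ideal_sq (dihedral_quandle 5) (dihedral_op 5) =
           generate (free_Abelian_group (dihedral_quandle 5))
             {e 1 - e 2 - e 4, e 2 + frag_cmul 2 (e 4), e 3 + frag_cmul 3 (e 4), frag_cmul 5 (e 4)}
       \<and> aug_ideal_group (dihedral_quandle 5) Mod aug_ideal_sq (dihedral_quandle 5) (dihedral_op 5)
           \<cong> integer_mod_group 5"
proof
  let ?D = "aug_ideal_sq (dihedral_quandle 5) (dihedral_op 5)"
  let ?K = "{u \<in> aug_ideal (dihedral_quandle 5). 5 dvd index_weight u}"
  note gen = dihedral5_kernel_subset_generate[OF e] dihedral5_generate_subset_aug_ideal_sq[OF e]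
  \<comment> \<open>This closes a cycle of inclusions: \<open>?D\<close> in \<open>?K\<close>,
    \<open>?K\<close> in the generated subgroup, and that subgroup in \<open>?D\<close>. All three
    coincide.\<close>
  have DK: "?D \<subseteq> ?K"
    using aug_ideal_sq_subset_index_weight_kernel[of 5] by simp
  with gen show "?D = generate (free_Abelian_group (dihedral_quandle 5))
      {e 1 - e 2 - e 4, e 2 + frag_cmul 2 (e 4), e 3 + frag_cmul 3 (e 4), frag_cmul 5 (e 4)}"
    by blast
  have "?D = ?K"
    using DK gen by blast
  then have ker: "kernel (aug_ideal_group (dihedral_quandle 5)) (integer_mod_group 5)
      (\<lambda>u. index_weight u mod int 5) = ?D"
    using kernel_index_weight_mod[of "dihedral_quandle 5" 5] by simp
  have "(\<lambda>u. index_weight u mod int 5) ` carrier (aug_ideal_group (dihedral_quandle 5)) =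
      carrier (integer_mod_group 5)"
    using index_weight_mod_surj[of 5] by (simp add: aug_ideal_group_def carrier_integer_mod_group)
  \<comment> \<open>Once \<open>?D\<close> is rewritten as the kernel, this is the first isomorphism
    theorem.\<close>
  then show "aug_ideal_group (dihedral_quandle 5) Mod ?D \<cong> integer_mod_group 5"
    unfolding ker[symmetric]
    by (intro group_hom.FactGroup_iso index_weight_mod_hom) simp
qed

end
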